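(* Let $k\in\{3,4,6\}$ and let $h_{\max}\ge 1$ be an integer. Let $(t(x),r(x))$ be a pair with $t(x)=ax+b$, $a,b\in\mathbb{Z}$, $a\neq 0$, and $\Phi_k(t(x)-1)=d\cdot r(x)$, where $d$ is the greatest common divisor of the coefficients of $\Phi_k(t(x)-1)\in\mathbb{Z}[x]$, and suppose that $d\le 4h$ for some integer $h$ with $1\le h\le h_{\max}$. Then $(t(x),r(x))$ is deduced from a pair $(t'(x),r'(x))$ of the same kind, namely $t'(x)=a'x+b'$ with $a',b'\in\mathbb{Z}$, $a'\neq 0$, and $\Phi_k(t'(x)-1)=d\cdot r'(x)$ with the same $d$ being the greatest common divisor of the coefficients of $\Phi_k(t'(x)-1)$, such that $|a'|\le 4h_{\max}$ and $|b'|<4h_{\max}$. In other words, in order to find all families with cofactor at most $h_{\max}$, up to deduction, it suffices to search over $t(x)=ax+b$ with $|a|\le a_{\max}=4h_{\max}$ and $|b|\le b_{\max}$ for $b_{\max}=4h_{\max}-1<a_{\max}$.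
   Context: $\Phi_k$ denotes the $k$-th cyclotomic polynomial. For polynomials $t,t',r,r'$ with integer coefficients, the pair $(t(x),r(x))$ is said to be deduced from $(t'(x),r'(x))$ if there are $u,v\in\mathbb{Z}$ with $u\neq 0$ and $(t(x),r(x))=(t'(ux+v),r'(ux+v))$. A family with embedding degree $k$ and cofactor $h$ is given by $t(x)=ax+b$, by $r(x)$ with $\Phi_k(t(x)-1)=d\cdot r(x)$ ($d$ the gcd of the coefficients), and by $q(x)=h\,r(x)+t(x)-1$, where the positive integer $h$ satisfies $4h\ge d$ (this inequality comes from the Hasse bound $4q(x)\ge t(x)^2$). *)

theory Defs
  imports Complex_Main "HOL-Computational_Algebra.Computational_Algebra"
begin

definition primitive_roots_unity :: "nat \<Rightarrow> complex set" where
  "primitive_roots_unity k = {z. z ^ k = 1 \<and> (\<forall>m. 0 < m \<and> m < k \<longrightarrow> z ^ m \<noteq> 1)}"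

text \<open>
  The polynomial with complex roots below has integer coefficients for every positive \<open>k\<close>;
  the description operator selects it inside \<open>\<int>[x]\<close>.
\<close>

definition cyclotomic :: "nat \<Rightarrow> int poly" where
  "cyclotomic k =
     (THE p. map_poly complex_of_int p = (\<Prod>z\<in>primitive_roots_unity k. [:- z, 1:]))"

text \<open>
  \<open>[:b, a:]\<close> is $ax + b$; \<open>content\<close> is the (nonnegative) gcd of the coefficients.
\<close>

definition family_pair :: "nat \<Rightarrow> int \<Rightarrow> int poly \<Rightarrow> int poly \<Rightarrow> bool" where
  "family_pair k d t r \<longleftrightarrow>
     (\<exists>a b. a \<noteq> 0 \<and> t = [:b, a:]) \<and>
     d = content (pcompose (cyclotomic k) (t - 1)) \<and>
     pcompose (cyclotomic k) (t - 1) = smult d r"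

definition deduced_from :: "int poly \<times> int poly \<Rightarrow> int poly \<times> int poly \<Rightarrow> bool" where
  "deduced_from = (\<lambda>(t, r) (t', r').
     \<exists>u v. u \<noteq> 0 \<and> (t, r) = (pcompose t' [:v, u:], pcompose r' [:v, u:]))"

text \<open>
  Families with embedding degree \<open>k\<close> and cofactor \<open>h\<close>.  The condition \<open>d \<le> 4 * h\<close> comes from
  the Hasse bound $4q(x) \ge t(x)^2$.
\<close>

definition is_family ::
  "nat \<Rightarrow> int \<Rightarrow> int poly \<Rightarrow> int poly \<Rightarrow> int poly \<Rightarrow> bool" where
  "is_family k h t r q \<longleftrightarrow>
     h > 0 \<and> (\<exists>d. family_pair k d t r \<and> d \<le> 4 * h) \<and> q = smult h r + t - 1"

end

theory Submission
  imports Defs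
begin

text \<open>
  For \<open>k \<in> {3, 4, 6}\<close> the polynomial $\Phi_k = x^2 + ex + 1$ is quadratic, so for $t = ax + b$ and
  $c = b - 1$ the content $d$ of $\Phi_k(t - 1)$ is the gcd of $a^2$, $a(2c + e)$ and $\Phi_k(c)$.
  Replacing $a$ by $a' = \gcd(a, d)$ and $b$ by its residue modulo $a'$ does not change this gcd:
  $d$ divides $a'^2 = \gcd(a^2, ad, d^2)$ and $a'(2c + e) = \gcd(a(2c + e), d(2c + e))$, while the
  new content divides $d$ because the old polynomial is obtained from the new one by an affine
  substitution. Finally $0 \le b' < a' \le d \le 4h$.
\<close>

text \<open>The factorization z^3 - 1 = (z - 1)(z^2 + z + 1) isolates the elements of order 3.
  Conversely, a root with z^2 = 1 would be z = -2, whence 4 = 1 and 3 = 0.\<close>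

lemma primitive_roots_unity_3:
  "primitive_roots_unity 3 = {z. z\<^sup>2 + z + 1 = 0}"
proof (intro set_eqI iffI)
  fix z assume "z \<in> primitive_roots_unity 3"
  then have z: "z ^ 3 = 1" "\<And>m. 0 < m \<Longrightarrow> m < 3 \<Longrightarrow> z ^ m \<noteq> 1"
    by (auto simp: primitive_roots_unity_def)
  have "(z - 1) * (z\<^sup>2 + z + 1) = 0" using z(1) by algebra
  then show "z \<in> {z. z\<^sup>2 + z + 1 = 0}" using z(2)[of 1] by simp
next
  fix z :: complex assume "z \<in> {z. z\<^sup>2 + z + 1 = 0}"
  then have z: "z\<^sup>2 + z + 1 = 0" by simp
  have "z ^ 3 = 1" using z by algebra
  moreover have "z \<noteq> 1" using z by auto
  moreover have "z\<^sup>2 \<noteq> 1"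
  proof
    assume "z\<^sup>2 = 1"
    with z have "(3::complex) = 0" by algebra
    then show False by simp
  qed
  ultimately show "z \<in> primitive_roots_unity 3"
    by (auto simp: primitive_roots_unity_def less_Suc_eq numeral_eq_Suc)
qed

lemma primitive_roots_unity_4:
  "primitive_roots_unity 4 = {z. z\<^sup>2 + 1 = 0}"
proof (intro set_eqI iffI)
  fix z assume "z \<in> primitive_roots_unity 4"
  then have z: "z ^ 4 = 1" "\<And>m. 0 < m \<Longrightarrow> m < 4 \<Longrightarrow> z ^ m \<noteq> 1"
    by (auto simp: primitive_roots_unity_def)
  have "(z\<^sup>2 - 1) * (z\<^sup>2 + 1) = 0" using z(1) by algebra
  then show "z \<in> {z. z\<^sup>2 + 1 = 0}" using z(2)[of 2] by simp
next
  fix z :: complex assume "z \<in> {z. z\<^sup>2 + 1 = 0}"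
  then have z: "z\<^sup>2 + 1 = 0" by simp
  have "z ^ 4 = 1" using z by algebra
  moreover have "z \<noteq> 1" using z by auto
  moreover have "z\<^sup>2 \<noteq> 1" using z by auto
  moreover have "z ^ 3 \<noteq> 1"
  proof
    assume "z ^ 3 = 1"
    \<comment> \<open>Since z^2 = -1, the cube is -z, so z = -1 and z^2 + 1 = 2.\<close>
    with z have "(2::complex) = 0" by algebra
    then show False by simp
  qed
  ultimately show "z \<in> primitive_roots_unity 4"
    by (auto simp: primitive_roots_unity_def less_Suc_eq numeral_eq_Suc)
qed

lemma primitive_roots_unity_6:
  "primitive_roots_unity 6 = {z. z\<^sup>2 - z + 1 = 0}"
proof (intro set_eqI iffI)
  fix z assume "z \<in> primitive_roots_unity 6"
  then have z: "z ^ 6 = 1" "\<And>m. 0 < m \<Longrightarrow> m < 6 \<Longrightarrow> z ^ m \<noteq> 1"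
    by (auto simp: primitive_roots_unity_def)
  \<comment> \<open>This is z^6 - 1 = (z^3 - 1)(z^3 + 1) with the second factor split; the first
    factor and z + 1 vanish only at elements of order less than 6.\<close>
  have "(z ^ 3 - 1) * ((z + 1) * (z\<^sup>2 - z + 1)) = 0" using z(1) by algebra
  moreover have "z + 1 \<noteq> 0"
  proof
    assume "z + 1 = 0"
    then have "z\<^sup>2 = 1" by algebra
    then show False using z(2)[of 2] by simp
  qed
  ultimately show "z \<in> {z. z\<^sup>2 - z + 1 = 0}" using z(2)[of 3] by simp
next
  fix z :: complex assume "z \<in> {z. z\<^sup>2 - z + 1 = 0}"
  then have z: "z\<^sup>2 - z + 1 = 0" by simp
  \<comment> \<open>As (z + 1)(z^2 - z + 1) = z^3 + 1, the powers z^4 and z^5 are -z and -z^2. Hence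
    z^4 = 1 would force z = -1, and z^5 = 1 would force z^2 = -1 and then z = 0.\<close>
  have z3: "z ^ 3 = - 1" using z by algebra
  have "z ^ 6 = 1" using z by algebra
  moreover have "z \<noteq> 1" using z by auto
  moreover have "z\<^sup>2 \<noteq> 1"
  proof
    assume "z\<^sup>2 = 1"
    with z have "(3::complex) = 0" by algebra
    then show False by simp
  qed
  moreover have "z ^ 3 \<noteq> 1" using z3 by simp
  moreover have "z ^ 4 \<noteq> 1"
  proof
    assume "z ^ 4 = 1"
    with z have "(3::complex) = 0" by algebra
    then show False by simp
  qed
  moreover have "z ^ 5 \<noteq> 1"
  proof
    assume "z ^ 5 = 1"
    with z have "(1::complex) = 0" by algebra
    then show False by simp
  qed
  ultimately show "z \<in> primitive_roots_unity 6"
    by (auto simp: primitive_roots_unity_def less_Suc_eq numeral_eq_Suc)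
qed

text \<open>The bound on \<open>e\<close> makes the discriminant e^2 - 4 negative, so the roots are
  two distinct complex conjugates and the product over the root set has exactly two factors.\<close>

lemma cyclotomic_quadratic:
  fixes e :: int
  assumes roots: "primitive_roots_unity k = {z. z\<^sup>2 + of_int e * z + 1 = 0}"
    and e: "\<bar>e\<bar> < 2"
  shows "cyclotomic k = [:1, e, 1:]"
proof -
  \<comment> \<open>The root in the upper half plane, from the quadratic formula.\<close>
  define w where "w = Complex (- real_of_int e / 2) (sqrt (1 - (real_of_int e)\<^sup>2 / 4))"
  have "e = -1 \<or> e = 0 \<or> e = 1" using e by auto
  then have pos: "0 < 1 - (real_of_int e)\<^sup>2 / 4" by auto
  have neq: "w \<noteq> cnj w" using pos by (simp add: w_def complex_eq_iff)
  have add: "w + cnj w = - of_int e" by (simp add: w_def complex_eq_iff)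
  have mult: "w * cnj w = 1"
    using pos by (simp add: w_def complex_eq_iff power2_eq_square field_simps)
  have factor: "z\<^sup>2 + of_int e * z + 1 = (z - w) * (z - cnj w)" for z
    using add mult by algebra
  have "primitive_roots_unity k = {w, cnj w}"
    unfolding roots factor by auto
  then have "(\<Prod>z\<in>primitive_roots_unity k. [:- z, 1:]) = [:- w, 1:] * [:- cnj w, 1:]"
    using neq by simp
  also have "\<dots> = [:w * cnj w, - (w + cnj w), 1:]" by simp
  also have "\<dots> = map_poly complex_of_int [:1, e, 1:]"
    unfolding add mult by (simp add: map_poly_pCons)
  finally have prod: "(\<Prod>z\<in>primitive_roots_unity k. [:- z, 1:]) = map_poly complex_of_int [:1, e, 1:]" .
  show ?thesis
    unfolding cyclotomic_def prod
    \<comment> \<open>Uniqueness holds because the embedding of the integers into the complex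
      numbers is injective on coefficients.\<close>
    by (rule the_equality) (auto simp: poly_eq_iff coeff_map_poly)
qed

lemma cyclotomic_3_4_6:
  assumes "k \<in> {3, 4, 6}"
  obtains e where "cyclotomic k = [:1, e, 1:]"
proof -
  have "cyclotomic 3 = [:1, 1, 1:]" "cyclotomic 4 = [:1, 0, 1:]" "cyclotomic 6 = [:1, -1, 1:]"
    by (rule cyclotomic_quadratic;
        simp add: primitive_roots_unity_3 primitive_roots_unity_4 primitive_roots_unity_6)+
  then show ?thesis using assms that by auto
qed

text \<open>A constant factor of the outer polynomial survives substitution, so composing can only
  enlarge the content.\<close>

lemma content_dvd_content_pcompose:
  fixes p q :: "'a::{factorial_semiring_gcd, semiring_gcd_mult_normalize, comm_ring_1} poly"
  shows "content p dvd content (pcompose p q)"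
proof -
  have "pcompose p q = smult (content p) (pcompose (primitive_part p) q)"
    by (metis content_times_primitive_part pcompose_smult)
  then show ?thesis by (simp add: content_smult)
qed

text \<open>The three terms are the coefficients of the expansion around b - 1; 2(b - 1) + e is the
  derivative of x^2 + ex + 1 there.\<close>

lemma dvd_content_quadratic_linear_iff:
  fixes a b d e :: int
  shows "d dvd content (pcompose [:1, e, 1:] ([:b, a:] - 1)) \<longleftrightarrow>
    d dvd a\<^sup>2 \<and> d dvd a * (2 * (b - 1) + e) \<and> d dvd (b - 1)\<^sup>2 + e * (b - 1) + 1"
proof -
  have "pcompose [:1, e, 1:] ([:b, a:] - 1) =
      [:(b - 1)\<^sup>2 + e * (b - 1) + 1, a * (2 * (b - 1) + e), a\<^sup>2:]"
    by (simp add: pcompose_pCons one_pCons algebra_simps power2_eq_square)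
  then show ?thesis
    by (auto simp: content_def cCons_def)
qed

lemma family_pair_reduce:
  assumes k: "k \<in> {3, 4, 6}" and fam: "family_pair k d t r"
  obtains a' b' r' where "family_pair k d [:b', a':] r'" "deduced_from (t, r) ([:b', a':], r')"
    "0 \<le> b'" "b' < a'" "a' \<le> d"
proof -
  obtain e where cyc: "cyclotomic k = [:1, e, 1:]" using k by (rule cyclotomic_3_4_6)
  let ?C = "\<lambda>t. pcompose (cyclotomic k) (t - 1)"
  obtain a b where a: "a \<noteq> 0" and t: "t = [:b, a:]"
    and d: "d = content (?C t)" and r: "?C t = smult d r"
    using fam unfolding family_pair_def by blast
  have "d dvd content (?C [:b, a:])" using d t by simp
  then have dvd: "d dvd a\<^sup>2" "d dvd a * (2 * (b - 1) + e)" "d dvd (b - 1)\<^sup>2 + e * (b - 1) + 1"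
    unfolding cyc dvd_content_quadratic_linear_iff by auto
  have content_nonneg: "content p \<ge> 0" for p :: "int poly"
    by (metis abs_ge_zero normalize_content normalize_int_def)
  \<comment> \<open>If \<open>d\<close> were 0, it could divide a^2 only for a = 0.\<close>
  have "d \<noteq> 0" using dvd(1) a by auto
  then have dpos: "d > 0" using d content_nonneg[of "?C t"] by linarith

  define a' where "a' = gcd a d"
  define u where "u = a div a'"
  define v where "v = b div a'"
  define b' where "b' = b mod a'"
  have a'pos: "a' > 0" using a by (simp add: a'_def)
  have au: "a = a' * u" by (simp add: u_def a'_def)
  have bv: "b = a' * v + b'" by (simp add: v_def b'_def)
  have u: "u \<noteq> 0" using a au by auto
  \<comment> \<open>Writing \<open>a'\<close> as a Bezout combination turns the gcd arguments into
    explicit combinations of multiples of \<open>d\<close>.\<close>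
  obtain x y where bez: "a' = x * a + y * d" unfolding a'_def by (metis bezout_int)
  have "a'\<^sup>2 = x\<^sup>2 * a\<^sup>2 + d * (2 * x * y * a + y\<^sup>2 * d)" unfolding bez by algebra
  then have dvd1: "d dvd a'\<^sup>2" using dvd(1) by simp
  have "a' * (2 * (b - 1) + e) = x * (a * (2 * (b - 1) + e)) + d * (y * (2 * (b - 1) + e))"
    unfolding bez by algebra
  then have dvd2: "d dvd a' * (2 * (b - 1) + e)" using dvd(2) by simp
  have "a' * (2 * (b' - 1) + e) = a' * (2 * (b - 1) + e) - 2 * v * a'\<^sup>2"
    unfolding bv by algebra
  then have dvd3: "d dvd a' * (2 * (b' - 1) + e)"
    using dvd1 dvd2 by (metis dvd_diff dvd_mult)
  \<comment> \<open>Taylor expansion of x^2 + ex + 1 at b - 1 with increment -v a'; the last two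
    coefficients are already known to be multiples of \<open>d\<close>.\<close>
  have "(b' - 1)\<^sup>2 + e * (b' - 1) + 1 =
      (b - 1)\<^sup>2 + e * (b - 1) + 1 - v * (a' * (2 * (b - 1) + e)) + v\<^sup>2 * a'\<^sup>2"
    unfolding bv by algebra
  then have "d dvd (b' - 1)\<^sup>2 + e * (b' - 1) + 1"
    using dvd(3) dvd1 dvd2 by (metis dvd_add dvd_diff dvd_mult)
  with dvd1 dvd3 have "d dvd content (?C [:b', a':])"
    unfolding cyc dvd_content_quadratic_linear_iff by blast
  moreover have tt': "t = pcompose [:b', a':] [:v, u:]"
    using au bv by (simp add: t pcompose_pCons)
  have CC: "?C t = pcompose (?C [:b', a':]) [:v, u:]"
    by (simp add: tt' pcompose_diff pcompose_1 flip: pcompose_assoc)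
  then have "content (?C [:b', a':]) dvd d"
    unfolding d by (simp add: content_dvd_content_pcompose)
  ultimately have d': "d = content (?C [:b', a':])"
    using dpos content_nonneg by (simp add: zdvd_antisym_nonneg)
  \<comment> \<open>Once the contents agree, \<open>r'\<close> is forced; its relation to
    \<open>r\<close> follows by cancelling the nonzero \<open>d\<close>.\<close>
  define r' where "r' = primitive_part (?C [:b', a':])"
  have r': "?C [:b', a':] = smult d r'"
    by (simp add: d' r'_def)
  have "smult d r = smult d (pcompose r' [:v, u:])"
    using r CC r' by (simp add: pcompose_smult)
  then have "r = pcompose r' [:v, u:]" using dpos by (auto simp: poly_eq_iff)
  then have "deduced_from (t, r) ([:b', a':], r')"
    using u tt' by (auto simp: deduced_from_def)
  moreover have "family_pair k d [:b', a':] r'"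
    unfolding family_pair_def using a'pos d' r' by auto
  moreover have "a' \<le> d" using dpos by (simp add: a'_def zdvd_imp_le)
  moreover have "0 \<le> b'" "b' < a'" using a'pos by (simp_all add: b'_def)
  ultimately show ?thesis using that by blast
qed

theorem lemma3p5:
  fixes k :: nat and hmax :: int
  assumes "k \<in> {3, 4, 6}" and "hmax \<ge> 1"
  shows "(\<forall>t r d. family_pair k d t r \<and> (\<exists>h. 1 \<le> h \<and> h \<le> hmax \<and> d \<le> 4 * h) \<longrightarrow>
            (\<exists>a' b' r'. family_pair k d [:b', a':] r' \<and>
               deduced_from (t, r) ([:b', a':], r') \<and>
               \<bar>a'\<bar> \<le> 4 * hmax \<and> \<bar>b'\<bar> < 4 * hmax)) \<and>
         (let amax = 4 * hmax; bmax = 4 * hmax - 1 in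
            bmax < amax \<and>
            (\<forall>h t r q. h \<le> hmax \<and> is_family k h t r q \<longrightarrow>
               (\<exists>a' b' r' q'. is_family k h [:b', a':] r' q' \<and>
                  deduced_from (t, r) ([:b', a':], r') \<and>
                  \<bar>a'\<bar> \<le> amax \<and> \<bar>b'\<bar> \<le> bmax)))"
proof -
  have bounds: "\<exists>a' b' r'. family_pair k d [:b', a':] r' \<and> deduced_from (t, r) ([:b', a':], r') \<and>
      \<bar>a'\<bar> \<le> 4 * hmax \<and> \<bar>b'\<bar> < 4 * hmax"
    if "family_pair k d t r" "h \<le> hmax" "d \<le> 4 * h" for t r d h
  proof -
    obtain a' b' r' where "family_pair k d [:b', a':] r'" "deduced_from (t, r) ([:b', a':], r')"
      and "0 \<le> b'" "b' < a'" "a' \<le> d"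
      using family_pair_reduce[OF assms(1) \<open>family_pair k d t r\<close>] by blast
    \<comment> \<open>Both absolute values drop, and the chain b' < a' \<le> d \<le> 4h \<le> 4
      \<open>hmax\<close> gives the bounds.\<close>
    moreover from this have "\<bar>a'\<bar> \<le> 4 * hmax" "\<bar>b'\<bar> < 4 * hmax" using that by auto
    ultimately show ?thesis by blast
  qed
  moreover have "\<exists>a' b' r' q'. is_family k h [:b', a':] r' q' \<and>
      deduced_from (t, r) ([:b', a':], r') \<and> \<bar>a'\<bar> \<le> 4 * hmax \<and> \<bar>b'\<bar> \<le> 4 * hmax - 1"
    if h: "h \<le> hmax" and fam: "is_family k h t r q" for h t r q
  proof -
    obtain d where "h > 0" and d: "family_pair k d t r" "d \<le> 4 * h"
      using fam unfolding is_family_def by blast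
    obtain a' b' r' where "family_pair k d [:b', a':] r'" "deduced_from (t, r) ([:b', a':], r')"
      "\<bar>a'\<bar> \<le> 4 * hmax" "\<bar>b'\<bar> < 4 * hmax"
      using bounds[OF d(1) h d(2)] by blast
    \<comment> \<open>The reduction preserves \<open>d\<close>, so the same cofactor
      \<open>h\<close> still satisfies d \<le> 4h, and \<open>q'\<close> is then determined by its
      defining formula.\<close>
    moreover from this have "is_family k h [:b', a':] r' (smult h r' + [:b', a':] - 1)"
      unfolding is_family_def using \<open>h > 0\<close> d(2) by blast
    ultimately show ?thesis by (metis zle_diff1_eq)
  qed
  ultimately show ?thesis unfolding Let_def by (intro conjI) (blast, simp, blast)
qed

end
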